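(* Let $X$ be a strongly regular graph. Then for any two edges $e$ and $f$ of $X$, the graphs $X\backslash e$ and $X\backslash f$ are cospectral with respect to the adjacency matrix, the Laplacian matrix, the unsigned Laplacian matrix and the normalized Laplacian matrix.
   Context: For a graph $X$ with adjacency matrix $A$ and diagonal degree matrix $D$: the Laplacian is $L=D-A$, the unsigned (signless) Laplacian is $S=D+A$, and the normalized Laplacian is $N=D^{-1/2}LD^{-1/2}$ (defined for graphs without isolated vertices). Two graphs are cospectral with respect to one of these matrices if the corresponding matrices have the same characteristic polynomial. $X\backslash e$ denotes the graph obtained from $X$ by deleting the edge $e$ (keeping all vertices). *)

theory Defs
  imports "Graph_Theory.Pair_Digraph" "Jordan_Normal_Form.Char_Poly"
begin

text \<open>
  A finite simple graph is a symmetric loop-free digraph (locale \<open>pair_graph\<close>): every edge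
  \<open>{u, v}\<close> is stored as the two arcs \<open>(u, v)\<close> and \<open>(v, u)\<close>. Hence the degree of a vertex is its
  out-degree, and deleting an edge removes both of its arcs.
\<close>

definition edges :: "'a pair_pre_digraph \<Rightarrow> 'a set set" where
  "edges X = {{u, v} | u v. (u, v) \<in> parcs X}"

definition delete_edge :: "'a pair_pre_digraph \<Rightarrow> 'a set \<Rightarrow> 'a pair_pre_digraph" where
  "delete_edge X e = \<lparr>pverts = pverts X, parcs = {(u, v) \<in> parcs X. {u, v} \<noteq> e}\<rparr>"

definition neighbours :: "'a pair_pre_digraph \<Rightarrow> 'a \<Rightarrow> 'a set" where
  "neighbours X v = {w. (v, w) \<in> parcs X}"

text \<open>
  Complete and edgeless graphs are not excluded, so this covers both usual conventions.
\<close>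

definition strongly_regular :: "'a pair_pre_digraph \<Rightarrow> bool" where
  "strongly_regular X \<longleftrightarrow> pair_graph X \<and>
     (\<exists>k a c :: nat.
        (\<forall>v \<in> pverts X. out_degree (with_proj X) v = k) \<and>
        (\<forall>u \<in> pverts X. \<forall>v \<in> pverts X. (u, v) \<in> parcs X \<longrightarrow>
            card (neighbours X u \<inter> neighbours X v) = a) \<and>
        (\<forall>u \<in> pverts X. \<forall>v \<in> pverts X. u \<noteq> v \<and> (u, v) \<notin> parcs X \<longrightarrow>
            card (neighbours X u \<inter> neighbours X v) = c))"

text \<open>
  The matrices of a graph are taken with respect to an ordering of its vertices, given as a list.
\<close>

definition vertex_ordering :: "'a pair_pre_digraph \<Rightarrow> 'a list \<Rightarrow> bool" where
  "vertex_ordering X vs \<longleftrightarrow> distinct vs \<and> set vs = pverts X"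

definition adjacency_matrix :: "'a pair_pre_digraph \<Rightarrow> 'a list \<Rightarrow> real mat" where
  "adjacency_matrix X vs =
     mat (length vs) (length vs) (\<lambda>(i, j). if (vs ! i, vs ! j) \<in> parcs X then 1 else 0)"

definition degree_matrix :: "'a pair_pre_digraph \<Rightarrow> 'a list \<Rightarrow> real mat" where
  "degree_matrix X vs = mat_diag (length vs) (\<lambda>i. real (out_degree (with_proj X) (vs ! i)))"

text \<open>
  As \<open>1 / sqrt 0 = 0\<close>, an isolated vertex gets the entry 0 (the usual convention). This matters
  only for graphs with isolated vertices.
\<close>

definition degree_matrix_inv_sqrt :: "'a pair_pre_digraph \<Rightarrow> 'a list \<Rightarrow> real mat" where
  "degree_matrix_inv_sqrt X vs =
     mat_diag (length vs) (\<lambda>i. 1 / sqrt (real (out_degree (with_proj X) (vs ! i))))"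

definition laplacian :: "'a pair_pre_digraph \<Rightarrow> 'a list \<Rightarrow> real mat" where
  "laplacian X vs = degree_matrix X vs - adjacency_matrix X vs"

definition unsigned_laplacian :: "'a pair_pre_digraph \<Rightarrow> 'a list \<Rightarrow> real mat" where
  "unsigned_laplacian X vs = degree_matrix X vs + adjacency_matrix X vs"

definition normalized_laplacian :: "'a pair_pre_digraph \<Rightarrow> 'a list \<Rightarrow> real mat" where
  "normalized_laplacian X vs =
     degree_matrix_inv_sqrt X vs * laplacian X vs * degree_matrix_inv_sqrt X vs"

text \<open>
  For a fixed graph with finitely many vertices the characteristic polynomial does not depend on
  the ordering; demanding equality for all orderings makes no choice.
\<close>

definition cospectral ::
    "('a pair_pre_digraph \<Rightarrow> 'a list \<Rightarrow> real mat) \<Rightarrow> 'a pair_pre_digraph \<Rightarrow> 'a pair_pre_digraph \<Rightarrow> bool" where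
  "cospectral M X Y \<longleftrightarrow>
     (\<forall>vs ws. vertex_ordering X vs \<longrightarrow> vertex_ordering Y ws \<longrightarrow>
        char_poly (M X vs) = char_poly (M Y ws))"

end

theory Submission
  imports Defs
begin

text \<open>
  All four matrices of \<open>X \ e\<close> are, up to a diagonal congruence for the normalized Laplacian, of the
  form \<open>B + F\<close> with \<open>B = \<alpha> I + \<beta> A\<close> and \<open>F\<close> supported on the two ends of \<open>e\<close>, with one entry on the
  diagonal and one off it. Since \<open>X\<close> is strongly regular, \<open>I\<close>, \<open>A\<close> and \<open>J\<close> span an algebra, so for
  generic \<open>\<alpha>\<close> the inverse of \<open>B\<close> lies in that span and its entries at the ends of an edge do not
  depend on the edge. By Sylvester's identity \<open>det (B + F)\<close> is \<open>det B\<close> times a \<open>2 \<times> 2\<close> determinant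
  built from these entries, so it does not depend on \<open>e\<close> either; as it is polynomial in \<open>\<alpha>\<close>, this
  extends to all \<open>\<alpha>\<close>.
\<close>

section \<open>Determinants of matrices indexed by lists\<close>

text \<open>Multiplying \<open>?M\<close> by the unipotent block matrix \<open>?L\<close> on either
  side clears the upper right block, leaving \<open>1 + A * B\<close> or \<open>1 + B * A\<close> as
  the only nontrivial diagonal block. Both products have the same determinant. The use below has
  \<open>m = 2\<close>.\<close>

lemma det_one_plus_mult_commute:
  fixes A B :: "'a :: idom mat"
  assumes A: "A \<in> carrier_mat n m" and B: "B \<in> carrier_mat m n"
  shows "det (1\<^sub>m n + A * B) = det (1\<^sub>m m + B * A)"
proof -
  let ?L = "four_block_mat (1\<^sub>m n) A (0\<^sub>m m n) (1\<^sub>m m)"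
  let ?M = "four_block_mat (1\<^sub>m n) (- A) B (1\<^sub>m m)"
  have L: "?L \<in> carrier_mat (n + m) (n + m)" and M: "?M \<in> carrier_mat (n + m) (n + m)"
    using A B by auto
  have "?L * ?M = four_block_mat (1\<^sub>m n + A * B) (0\<^sub>m n m) B (1\<^sub>m m)"
    using A B by (subst mult_four_block_mat[of _ n n _ m _ m]) auto
  then have det_LM: "det (?L * ?M) = det (1\<^sub>m n + A * B)"
    using A B by (simp add: det_four_block_mat_upper_right_zero[of _ n _ m])
  have "?M * ?L = four_block_mat (1\<^sub>m n) (0\<^sub>m n m) B (1\<^sub>m m + B * A)"
    using A B by (subst mult_four_block_mat[of _ n n _ m _ m])
      (auto simp: comm_add_mat[of "B * A" m m])
  then have det_ML: "det (?M * ?L) = det (1\<^sub>m m + B * A)"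
    using A B by (simp add: det_four_block_mat_upper_right_zero[of _ n _ m])
  show ?thesis
    using det_LM det_ML det_mult[OF L M] det_mult[OF M L] by (simp add: mult.commute)
qed

text \<open>Entries depend on list elements, not positions, so matrix identities become identities
  between functions of vertices. The rectangular case serves to factor a perturbation through the
  two ends of an edge.\<close>

definition list_mat :: "'b list \<Rightarrow> 'c list \<Rightarrow> ('b \<Rightarrow> 'c \<Rightarrow> 'a) \<Rightarrow> 'a mat" where
  "list_mat us vs g = mat (length us) (length vs) (\<lambda>(i, j). g (us ! i) (vs ! j))"

lemma list_mat_carrier [simp]: "list_mat us vs g \<in> carrier_mat (length us) (length vs)"
  and list_mat_dim [simp]: "dim_row (list_mat us vs g) = length us"
    "dim_col (list_mat us vs g) = length vs"
  and list_mat_index [simp]: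
    "i < length us \<Longrightarrow> j < length vs \<Longrightarrow> list_mat us vs g $$ (i, j) = g (us ! i) (vs ! j)"
  by (auto simp: list_mat_def)

lemma list_mat_cong:
  "(\<And>x y. x \<in> set us \<Longrightarrow> y \<in> set vs \<Longrightarrow> g x y = h x y) \<Longrightarrow> list_mat us vs g = list_mat us vs h"
  by (intro eq_matI) auto

lemma list_mat_mult:
  fixes g :: "'b \<Rightarrow> 'c \<Rightarrow> 'a :: semiring_0"
  assumes "distinct vs"
  shows "list_mat us vs g * list_mat vs ws h = list_mat us ws (\<lambda>x y. \<Sum>w\<in>set vs. g x w * h w y)"
proof (rule eq_matI)
  fix i j
  assume "i < dim_row (list_mat us ws (\<lambda>x y. \<Sum>w\<in>set vs. g x w * h w y))"
    and "j < dim_col (list_mat us ws (\<lambda>x y. \<Sum>w\<in>set vs. g x w * h w y))"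
  then have ij: "i < length us" "j < length ws" by auto
  have bij: "bij_betw ((!) vs) {0..<length vs} (set vs)"
    using assms by (simp add: bij_betw_nth atLeast0LessThan)
  show "(list_mat us vs g * list_mat vs ws h) $$ (i, j)
      = list_mat us ws (\<lambda>x y. \<Sum>w\<in>set vs. g x w * h w y) $$ (i, j)"
    using ij by (simp add: scalar_prod_def sum.reindex_bij_betw[OF bij, symmetric])
qed auto

lemma list_mat_add: "list_mat us vs g + list_mat us vs h = list_mat us vs (\<lambda>x y. g x y + h x y)"
  by (intro eq_matI) auto

lemma one_mat_eq_list_mat:
  "distinct vs \<Longrightarrow> 1\<^sub>m (length vs) = list_mat vs vs (\<lambda>x y. if x = y then 1 else 0)"
  by (intro eq_matI) (auto simp: nth_eq_iff_index_eq)

lemma mat_diag_eq_list_mat: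
  "distinct vs \<Longrightarrow> mat_diag (length vs) (\<lambda>i. g (vs ! i)) = list_mat vs vs (\<lambda>x y. if x = y then g y else 0)"
  by (intro eq_matI) (auto simp: mat_diag_def nth_eq_iff_index_eq)

lemma list_mat_diag_congruence:
  fixes g :: "'b \<Rightarrow> 'b \<Rightarrow> 'a :: semiring_0"
  assumes "distinct vs"
  shows "list_mat vs vs (\<lambda>x y. if x = y then d y else 0) * list_mat vs vs g
      * list_mat vs vs (\<lambda>x y. if x = y then d y else 0) = list_mat vs vs (\<lambda>x y. d x * g x y * d y)"
  unfolding list_mat_mult[OF assms]
  by (rule list_mat_cong) (auto simp: if_distrib[of "\<lambda>z. z * _"]
        if_distrib[of "\<lambda>z. _ * z"] cong: if_cong)

lemma det_list_mat_reorder: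
  fixes g :: "'b \<Rightarrow> 'b \<Rightarrow> 'a :: comm_ring_1"
  assumes vs: "distinct vs" and ws: "distinct ws" and set: "set vs = set ws"
  shows "det (list_mat vs vs g) = det (list_mat ws ws g)"
proof -
  let ?one = "\<lambda>x y. if x = y then 1 else 0 :: 'a"
  \<comment> \<open>\<open>P\<close> is the permutation matrix between the two orderings and
    \<open>Q\<close> is its inverse, so the two matrices are similar.\<close>
  define P where "P = list_mat vs ws ?one"
  define Q where "Q = list_mat ws vs ?one"
  have len: "length ws = length vs"
    using assms by (metis distinct_card)
  have c: "P \<in> carrier_mat (length vs) (length vs)" "Q \<in> carrier_mat (length vs) (length vs)"
    "list_mat ws ws g \<in> carrier_mat (length vs) (length vs)"
    unfolding P_def Q_def by (auto simp: list_mat_def len)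
  have "P * Q = 1\<^sub>m (length vs)"
    unfolding P_def Q_def list_mat_mult[OF ws] one_mat_eq_list_mat[OF vs]
    by (rule list_mat_cong) (auto simp: set if_distrib[of "\<lambda>z. z * _"] cong: if_cong)
  then have PQ: "det P * det Q = 1"
    using det_mult[OF c(1,2)] by simp
  have "P * list_mat ws ws g * Q = list_mat vs vs g"
    unfolding P_def Q_def list_mat_mult[OF ws]
    by (rule list_mat_cong)
      (auto simp: set if_distrib[of "\<lambda>z. z * _"]
        if_distrib[of "\<lambda>z. _ * z"] cong: if_cong)
  then have "det (list_mat vs vs g) = det P * det (list_mat ws ws g) * det Q"
    using c by (metis det_mult mult_carrier_mat)
  with PQ show ?thesis
    by (metis mult.commute mult.left_commute mult_1_right)
qed

lemma poly_char_poly_list_mat: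
  fixes g :: "'b \<Rightarrow> 'b \<Rightarrow> real"
  assumes "distinct vs"
  shows "poly (char_poly (list_mat vs vs g)) x
       = det (list_mat vs vs (\<lambda>y z. (if y = z then x else 0) - g y z))"
  unfolding char_poly_def
  by (rule poly_det_cong[of _ "length vs"])
    (auto simp: char_poly_matrix_def nth_eq_iff_index_eq[OF assms])

section \<open>Strongly regular graphs\<close>

lemma out_degree_eq_card_neighbours: "out_degree (with_proj X) v = card (neighbours X v)"
proof -
  have "out_arcs (with_proj X) v = Pair v ` neighbours X v"
    by (auto simp: out_arcs_def neighbours_def)
  then show ?thesis
    by (simp add: out_degree_def card_image inj_on_def)
qed

locale strongly_regular_graph = pair_graph X for X :: "'a pair_pre_digraph" +
  fixes k a c :: nat
  assumes card_neighbours: "v \<in> pverts X \<Longrightarrow> card (neighbours X v) = k"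
    and card_common_adjacent: "(u, v) \<in> parcs X \<Longrightarrow> card (neighbours X u \<inter> neighbours X v) = a"
    and card_common_nonadjacent: "u \<in> pverts X \<Longrightarrow> v \<in> pverts X \<Longrightarrow> u \<noteq> v \<Longrightarrow> (u, v) \<notin> parcs X \<Longrightarrow>
      card (neighbours X u \<inter> neighbours X v) = c"
begin

abbreviation adj :: "'a \<Rightarrow> 'a \<Rightarrow> real" where
  "adj x y \<equiv> if (x, y) \<in> parcs X then 1 else 0"

lemma arc_in_pverts: "(u, v) \<in> parcs X \<Longrightarrow> u \<in> pverts X" "(u, v) \<in> parcs X \<Longrightarrow> v \<in> pverts X"
  using arc_fst_in_verts arc_snd_in_verts by fastforce+

lemma arc_sym: "(u, v) \<in> parcs X \<longleftrightarrow> (v, u) \<in> parcs X"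
  using pair_sym_arcs by (auto simp: symmetric_def arcs_ends_def arc_to_ends_def dest: symD)

lemma arc_irrefl: "(u, u) \<notin> parcs X"
  using pair_no_loops by fastforce

lemma neighbours_subset: "neighbours X v \<subseteq> pverts X"
  using arc_in_pverts by (auto simp: neighbours_def)

lemma sum_adj: "x \<in> pverts X \<Longrightarrow> (\<Sum>w\<in>pverts X. adj x w) = k"
proof -
  assume x: "x \<in> pverts X"
  have "(\<Sum>w\<in>pverts X. adj x w) = card (pverts X \<inter> neighbours X x)"
    using pair_finite_verts by (simp add: sum.If_cases neighbours_def)
  then show ?thesis
    using x neighbours_subset by (simp add: card_neighbours Int_absorb1)
qed

text \<open>These are the entries of A^2: by symmetry of the arcs, walks from x to y of length two
  correspond to common neighbours. Thus A^2 = k I + a A + c (J - I - A).\<close>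

lemma sum_adj_adj:
  assumes "x \<in> pverts X" "y \<in> pverts X"
  shows "(\<Sum>w\<in>pverts X. adj x w * adj w y)
       = (if x = y then k else if (x, y) \<in> parcs X then a else c)"
proof -
  have "(\<Sum>w\<in>pverts X. adj x w * adj w y)
      = (\<Sum>w\<in>pverts X. if w \<in> neighbours X x \<inter> neighbours X y then 1 else 0)"
    by (intro sum.cong) (auto simp: neighbours_def arc_sym)
  also have "\<dots> = card (pverts X \<inter> (neighbours X x \<inter> neighbours X y))"
    using pair_finite_verts by (simp only: sum.If_cases) (simp add: Int_def conj_ac)
  also have "pverts X \<inter> (neighbours X x \<inter> neighbours X y) = neighbours X x \<inter> neighbours X y"
    using neighbours_subset by blast
  finally show ?thesis
    using assms card_neighbours card_common_adjacent card_common_nonadjacent by auto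
qed

section \<open>Determinants of \<alpha> I + \<beta> A perturbed at the ends of an edge\<close>

definition perturbed :: "real \<Rightarrow> real \<Rightarrow> 'a set \<Rightarrow> real \<Rightarrow> real \<Rightarrow> 'a \<Rightarrow> 'a \<Rightarrow> real" where
  "perturbed \<alpha> \<beta> e \<gamma> \<delta> x y = (if x = y then \<alpha> else 0) + \<beta> * adj x y
     + (if x \<in> e \<and> y \<in> e then if x = y then \<gamma> else \<delta> else 0)"

text \<open>The inverse is sought as p I + q A + r J. On the all-ones vector \<alpha> I + \<beta> A
  acts as \<alpha> + \<beta> k. On the orthogonal complement A is a root of z^2 - (a - c) z - (k -
  c), and the first hypothesis says that the product of \<alpha> + \<beta> z over both roots z is
  nonzero.\<close>

lemma right_inverse_unperturbed:
  fixes \<alpha> \<beta> :: real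
  assumes \<Delta>: "\<alpha>\<^sup>2 + \<alpha> * \<beta> * (real a - real c) - \<beta>\<^sup>2 * (real k - real c) \<noteq> 0"
    and \<theta>: "\<alpha> + \<beta> * k \<noteq> 0"
  shows "\<exists>p q r. \<forall>vs. vertex_ordering X vs \<longrightarrow>
      list_mat vs vs (perturbed \<alpha> \<beta> {} 0 0)
        * list_mat vs vs (\<lambda>x y. (if x = y then p else 0) + q * adj x y + r)
      = 1\<^sub>m (length vs)"
proof -
  \<comment> \<open>Comparing coefficients of I, A and J in (\<alpha> I + \<beta> A)(p I + q A + r
    J) = I gives the equations \<open>I\<close>, \<open>A\<close>, \<open>J\<close> below. Cramer's
    rule on the first two yields p and q; the third then yields r.\<close>
  define t where "t = 1 / (\<alpha>\<^sup>2 + \<alpha> * \<beta> * (real a - real c) - \<beta>\<^sup>2 * (real k - real c))"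
  define p where "p = (\<alpha> + \<beta> * (real a - real c)) * t"
  define q where "q = - \<beta> * t"
  define r where "r = - \<beta> * q * c / (\<alpha> + \<beta> * k)"
  have "(\<alpha>\<^sup>2 + \<alpha> * \<beta> * (real a - real c) - \<beta>\<^sup>2 * (real k - real c)) * t = 1"
    using \<Delta> by (simp add: t_def)
  then have I: "\<alpha> * p + \<beta> * q * (real k - real c) = 1"
    by (simp add: p_def q_def algebra_simps power2_eq_square)
  have A: "\<alpha> * q + \<beta> * p + \<beta> * q * (real a - real c) = 0"
    by (simp add: p_def q_def algebra_simps)
  have "(\<alpha> + \<beta> * k) * r = - \<beta> * q * c"
    using \<theta> by (simp add: r_def)
  then have J: "\<alpha> * r + \<beta> * q * c + \<beta> * r * k = 0"
    by (simp add: algebra_simps)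
  show ?thesis
  proof (intro exI allI impI)
    fix vs assume "vertex_ordering X vs"
    then have vs: "distinct vs" "set vs = pverts X"
      by (auto simp: vertex_ordering_def)
    show "list_mat vs vs (perturbed \<alpha> \<beta> {} 0 0)
          * list_mat vs vs (\<lambda>x y. (if x = y then p else 0) + q * adj x y + r) = 1\<^sub>m (length vs)"
      unfolding list_mat_mult[OF vs(1)] one_mat_eq_list_mat[OF vs(1)]
    proof (rule list_mat_cong)
      fix x y assume "x \<in> set vs" "y \<in> set vs"
      then have xy: "x \<in> pverts X" "y \<in> pverts X" using vs by auto
      have "(\<Sum>w\<in>set vs. perturbed \<alpha> \<beta> {} 0 0 x w * ((if w = y then p else 0) + q * adj w y + r))
        = (\<Sum>w\<in>pverts X. (if w = x then \<alpha> * ((if x = y then p else 0) + q * adj x y + r) else 0)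
            + (if w = y then \<beta> * p * adj x y else 0) + \<beta> * q * (adj x w * adj w y) + \<beta> * r * adj x w)"
        unfolding vs(2) perturbed_def by (intro sum.cong) (auto simp: algebra_simps)
      also have "\<dots> = \<alpha> * ((if x = y then p else 0) + q * adj x y + r) + \<beta> * p * adj x y
          + \<beta> * q * (if x = y then k else if (x, y) \<in> parcs X then a else c) + \<beta> * r * k"
        using pair_finite_verts xy
        by (simp only: sum.distrib sum_distrib_left[symmetric] sum_adj sum_adj_adj sum.delta if_True)
      also have "\<dots> = (if x = y then 1 else 0)"
        using I A J arc_irrefl by (auto simp: algebra_simps)
      finally show "(\<Sum>w\<in>set vs. perturbed \<alpha> \<beta> {} 0 0 x w * ((if w = y then p else 0) + q * adj w y + r))
          = (if x = y then 1 else 0)" .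
    qed
  qed
qed

text \<open>The factor \<open>d\<close> is fixed before the ordering and the edge. This is possible
  because the inverse has the same entries at the ends of every edge: p + r on the diagonal and q +
  r off it.\<close>

lemma det_perturbed_generic:
  fixes \<alpha> \<beta> \<gamma> \<delta> :: real
  assumes \<Delta>: "\<alpha>\<^sup>2 + \<alpha> * \<beta> * (real a - real c) - \<beta>\<^sup>2 * (real k - real c) \<noteq> 0"
    and \<theta>: "\<alpha> + \<beta> * k \<noteq> 0"
  obtains d :: real where
    "\<And>vs u v. vertex_ordering X vs \<Longrightarrow> (u, v) \<in> parcs X \<Longrightarrow>
      det (list_mat vs vs (perturbed \<alpha> \<beta> {u, v} \<gamma> \<delta>)) = det (list_mat vs vs (perturbed \<alpha> \<beta> {} 0 0)) * d"
proof -
  obtain p q r :: real where inv: "\<And>vs. vertex_ordering X vs \<Longrightarrow>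
      list_mat vs vs (perturbed \<alpha> \<beta> {} 0 0)
        * list_mat vs vs (\<lambda>x y. (if x = y then p else 0) + q * adj x y + r)
      = 1\<^sub>m (length vs)"
    using right_inverse_unperturbed[OF \<Delta> \<theta>] by blast
  \<comment> \<open>This is I plus the product of the 2 x 2 matrices with diagonal entries \<gamma>
    and p + r and off-diagonal entries \<delta> and q + r.\<close>
  let ?D = "mat 2 2 (\<lambda>(i, j). if i = j then 1 + \<gamma> * (p + r) + \<delta> * (q + r) else \<gamma> * (q + r) + \<delta> * (p + r))"
  show ?thesis
  proof
    fix vs u v assume ord: "vertex_ordering X vs" and uv: "(u, v) \<in> parcs X"
    then have vs: "distinct vs" "set vs = pverts X"
      by (auto simp: vertex_ordering_def)
    have ne: "u \<noteq> v" and vu: "(v, u) \<in> parcs X" and V: "u \<in> pverts X" "v \<in> pverts X"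
      using uv arc_irrefl arc_sym arc_in_pverts by auto
    let ?n = "length vs"
    define B where "B = list_mat vs vs (perturbed \<alpha> \<beta> {} 0 0)"
    define G where "G = list_mat vs vs (\<lambda>x y. (if x = y then p else 0) + q * adj x y + r)"
    \<comment> \<open>\<open>U * Y\<close> factors the perturbation through the two coordinates u
      and v.\<close>
    define U where "U = list_mat vs [u, v] (\<lambda>x y. if x = y then 1 else 0 :: real)"
    define Y where "Y = list_mat [u, v] vs
      (\<lambda>x y. if y \<in> {u, v} then if x = y then \<gamma> else \<delta> else 0)"
    have c: "B \<in> carrier_mat ?n ?n" "G \<in> carrier_mat ?n ?n" "U \<in> carrier_mat ?n 2" "Y \<in> carrier_mat 2 ?n"
      unfolding B_def G_def U_def Y_def by (auto simp: list_mat_def)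
    have BG: "B * G = 1\<^sub>m ?n"
      unfolding B_def G_def by (rule inv[OF ord])
    have UY: "U * Y = list_mat vs vs (\<lambda>x y. if x \<in> {u, v} \<and> y \<in> {u, v} then if x = y then \<gamma> else \<delta> else 0)"
      unfolding U_def Y_def using ne by (subst list_mat_mult) (auto intro!: list_mat_cong)
    have "list_mat vs vs (perturbed \<alpha> \<beta> {u, v} \<gamma> \<delta>) = B + U * Y"
      unfolding B_def UY list_mat_add by (rule list_mat_cong) (simp add: perturbed_def)
    \<comment> \<open>The right inverse lets \<open>B\<close> be pulled out on the left of the whole
      sum.\<close>
    also have "U * Y = B * (G * U * Y)"
    proof -
      have "B * (G * U * Y) = B * G * (U * Y)"
        by (simp only: assoc_mult_mat[OF c(2,3,4)]
            assoc_mult_mat[OF c(1,2) mult_carrier_mat[OF c(3,4)]])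
      then show ?thesis using BG c by simp
    qed
    also have "B + B * (G * U * Y) = B * (1\<^sub>m ?n + G * U * Y)"
      using c mult_add_distrib_mat[of B ?n ?n "1\<^sub>m ?n" ?n "G * U * Y"] by simp
    finally have "det (list_mat vs vs (perturbed \<alpha> \<beta> {u, v} \<gamma> \<delta>)) = det B * det (1\<^sub>m ?n + G * U * Y)"
      using c by (simp add: det_mult[of _ ?n])
    also have "det (1\<^sub>m ?n + G * U * Y) = det (1\<^sub>m 2 + Y * (G * U))"
      using c by (intro det_one_plus_mult_commute) auto
    also have "Y * (G * U) = list_mat [u, v] [u, v] (\<lambda>x y.
        (if x = u then \<gamma> else \<delta>) * ((if u = y then p else 0) + q * adj u y + r)
      + (if x = v then \<gamma> else \<delta>) * ((if v = y then p else 0) + q * adj v y + r))"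
    proof -
      have GU: "G * U = list_mat vs [u, v] (\<lambda>x y. (if x = y then p else 0) + q * adj x y + r)"
        unfolding G_def U_def list_mat_mult[OF vs(1)]
        using V pair_finite_verts by (intro list_mat_cong)
          (auto simp: vs(2) if_distrib[of "\<lambda>z. _ * z"] cong: if_cong)
      show ?thesis
        unfolding Y_def GU list_mat_mult[OF vs(1)]
      proof (rule list_mat_cong)
        fix x y assume "x \<in> set [u, v]" "y \<in> set [u, v]"
        let ?g = "\<lambda>w. (if w = y then p else 0) + q * adj w y + r"
        have "(\<Sum>w\<in>set vs. (if w \<in> {u, v} then if x = w then \<gamma> else \<delta> else 0) * ?g w)
          = (\<Sum>w\<in>{u, v}. (if x = w then \<gamma> else \<delta>) * ?g w)"
          using V pair_finite_verts unfolding vs(2) by (intro sum.mono_neutral_cong_right) auto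
        also have "\<dots> = (if x = u then \<gamma> else \<delta>) * ?g u + (if x = v then \<gamma> else \<delta>) * ?g v"
          using ne by simp
        finally show "(\<Sum>w\<in>set vs. (if w \<in> {u, v} then if x = w then \<gamma> else \<delta> else 0) * ?g w)
          = (if x = u then \<gamma> else \<delta>) * ?g u + (if x = v then \<gamma> else \<delta>) * ?g v" .
      qed
    qed
    also have "1\<^sub>m 2 + \<dots> = ?D"
      using ne uv vu arc_irrefl by (intro eq_matI) (auto simp: less_2_cases_iff)
    finally show "det (list_mat vs vs (perturbed \<alpha> \<beta> {u, v} \<gamma> \<delta>))
        = det (list_mat vs vs (perturbed \<alpha> \<beta> {} 0 0)) * det ?D"
      unfolding B_def .
  qed
qed

text \<open>Both determinants are polynomials in \<alpha> that agree wherever the generic lemma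
  applies, that is, off finitely many values of \<alpha>.\<close>

lemma det_perturbed_eq:
  assumes vs: "vertex_ordering X vs" and ws: "vertex_ordering X ws"
    and e: "e \<in> edges X" and f: "f \<in> edges X"
  shows "det (list_mat vs vs (perturbed \<alpha> \<beta> e \<gamma> \<delta>)) = det (list_mat ws ws (perturbed \<alpha> \<beta> f \<gamma> \<delta>))"
proof -
  obtain u v u' v' where uv: "e = {u, v}" "(u, v) \<in> parcs X" and uv': "f = {u', v'}" "(u', v') \<in> parcs X"
    using e f by (auto simp: edges_def)
  \<comment> \<open>Taking the characteristic polynomial of the negated matrix with \<alpha> = 0
    makes \<alpha> the polynomial variable.\<close>
  define P where "P us g = char_poly (list_mat us us (\<lambda>x y. - perturbed 0 \<beta> g \<gamma> \<delta> x y))" for us g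
  have P: "poly (P us g) x = det (list_mat us us (perturbed x \<beta> g \<gamma> \<delta>))"
    if "vertex_ordering X us" for us g x
    using that unfolding P_def
    by (subst poly_char_poly_list_mat)
      (auto simp: vertex_ordering_def perturbed_def intro!: arg_cong[of _ _ det] list_mat_cong)
  \<comment> \<open>The two genericity conditions as polynomials in \<alpha>. Both are monic, hence
    nonzero for every \<beta>, so they can be cancelled from a product that vanishes
    everywhere.\<close>
  let ?\<Delta> = "[:- \<beta>\<^sup>2 * (real k - real c), \<beta> * (real a - real c), 1:]" and ?\<theta> = "[:\<beta> * k, 1:]"
  have "poly ((P vs e - P ws f) * ?\<Delta> * ?\<theta>) x = 0" for x
  proof (cases "poly ?\<Delta> x = 0 \<or> poly ?\<theta> x = 0")
    case False
    then have "x\<^sup>2 + x * \<beta> * (real a - real c) - \<beta>\<^sup>2 * (real k - real c) \<noteq> 0" and "x + \<beta> * k \<noteq> 0"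
      by (auto simp: algebra_simps power2_eq_square)
    then obtain d where d: "\<And>us u v. vertex_ordering X us \<Longrightarrow> (u, v) \<in> parcs X \<Longrightarrow>
        det (list_mat us us (perturbed x \<beta> {u, v} \<gamma> \<delta>)) = det (list_mat us us (perturbed x \<beta> {} 0 0)) * d"
      using det_perturbed_generic by metis
    have "det (list_mat vs vs (perturbed x \<beta> {} 0 0)) = det (list_mat ws ws (perturbed x \<beta> {} 0 0))"
      using vs ws by (intro det_list_mat_reorder) (auto simp: vertex_ordering_def)
    then have "poly (P vs e) x = poly (P ws f) x"
      using d vs ws uv uv' by (simp add: P)
    then show ?thesis by simp
  qed (auto simp only: poly_mult mult_zero_left mult_zero_right)
  then have "(P vs e - P ws f) * ?\<Delta> * ?\<theta> = 0"
    using poly_all_0_iff_0 by blast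
  then have "P vs e = P ws f"
    unfolding mult_eq_0_iff by simp
  then show ?thesis
    using P vs ws by metis
qed

text \<open>The family \<open>perturbed\<close> is closed under passing from M to x I - M, so the
  determinant identity applies at each x.\<close>

lemma char_poly_perturbed_eq:
  assumes "vertex_ordering X vs" "vertex_ordering X ws" "e \<in> edges X" "f \<in> edges X"
  shows "char_poly (list_mat vs vs (perturbed \<alpha> \<beta> e \<gamma> \<delta>))
       = char_poly (list_mat ws ws (perturbed \<alpha> \<beta> f \<gamma> \<delta>))"
proof (rule iffD1[OF poly_eq_poly_eq_iff], rule ext)
  fix x
  have "poly (char_poly (list_mat us us (perturbed \<alpha> \<beta> g \<gamma> \<delta>))) x
      = det (list_mat us us (perturbed (x - \<alpha>) (- \<beta>) g (- \<gamma>) (- \<delta>)))"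
    if "vertex_ordering X us" for us g
    using that
    by (subst poly_char_poly_list_mat)
      (auto simp: vertex_ordering_def perturbed_def intro!: arg_cong[of _ _ det] list_mat_cong)
  then show "poly (char_poly (list_mat vs vs (perturbed \<alpha> \<beta> e \<gamma> \<delta>))) x
      = poly (char_poly (list_mat ws ws (perturbed \<alpha> \<beta> f \<gamma> \<delta>))) x"
    using det_perturbed_eq[OF assms] assms by simp
qed

section \<open>Deleting an edge\<close>

lemma vertex_ordering_delete_edge [simp]: "vertex_ordering (delete_edge X e) = vertex_ordering X"
  by (simp add: fun_eq_iff vertex_ordering_def delete_edge_def)

lemma degree_delete_edge:
  assumes e: "e \<in> edges X" and x: "x \<in> pverts X"
  shows "real (out_degree (with_proj (delete_edge X e)) x) = (if x \<in> e then real k - 1 else k)"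
proof -
  obtain u v where uv: "e = {u, v}" "(u, v) \<in> parcs X" "(v, u) \<in> parcs X"
    using e arc_sym by (auto simp: edges_def)
  have fin: "finite (neighbours X x)"
    using neighbours_subset pair_finite_verts finite_subset by blast
  have *: "real (card (neighbours X x - {w})) = real k - 1" if "w \<in> neighbours X x" for w
  proof -
    \<comment> \<open>Positivity makes the natural-number subtraction in the cardinality agree with
      real subtraction.\<close>
    have "card (neighbours X x) > 0"
      using that fin by (auto simp: card_gt_0_iff)
    then show ?thesis
      using card_neighbours[OF x] that by (simp add: card_Diff_singleton of_nat_diff)
  qed
  have "neighbours (delete_edge X e) x
      = (if x = u then neighbours X x - {v} else if x = v then neighbours X x - {u} else neighbours X x)"
    using uv arc_irrefl by (auto simp: neighbours_def delete_edge_def doubleton_eq_iff)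
  moreover have "x = u \<Longrightarrow> v \<in> neighbours X x" "x = v \<Longrightarrow> u \<in> neighbours X x"
    using uv by (auto simp: neighbours_def)
  ultimately show ?thesis
    using * card_neighbours[OF x] uv(1) by (auto simp: out_degree_eq_card_neighbours)
qed

context
  fixes vs e
  assumes vs: "vertex_ordering X vs" and e: "e \<in> edges X"
begin

lemma adjacency_matrix_delete_edge:
  "adjacency_matrix (delete_edge X e) vs = list_mat vs vs (perturbed 0 1 e 0 (- 1))"
proof -
  have "(if (x, y) \<in> parcs (delete_edge X e) then 1 else 0) = perturbed 0 1 e 0 (- 1) x y" for x y
    using e arc_irrefl arc_sym
    by (auto simp: edges_def delete_edge_def perturbed_def doubleton_eq_iff)
  then show ?thesis
    by (simp add: adjacency_matrix_def list_mat_def)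
qed

lemma degree_matrix_delete_edge:
  "degree_matrix (delete_edge X e) vs = list_mat vs vs (perturbed k 0 e (- 1) 0)"
proof -
  have "distinct vs" "set vs = pverts X"
    using vs by (auto simp: vertex_ordering_def)
  then show ?thesis
    unfolding degree_matrix_def
    by (subst mat_diag_eq_list_mat[where g = "\<lambda>x. real (out_degree (with_proj (delete_edge X e)) x)"])
      (auto intro!: list_mat_cong simp: perturbed_def degree_delete_edge[OF e])
qed

lemma laplacian_delete_edge:
  "laplacian (delete_edge X e) vs = list_mat vs vs (perturbed k (- 1) e (- 1) 1)"
  unfolding laplacian_def adjacency_matrix_delete_edge degree_matrix_delete_edge
  by (intro eq_matI) (auto simp: perturbed_def)

lemma unsigned_laplacian_delete_edge:
  "unsigned_laplacian (delete_edge X e) vs = list_mat vs vs (perturbed k 1 e (- 1) (- 1))"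
  unfolding unsigned_laplacian_def adjacency_matrix_delete_edge degree_matrix_delete_edge
  by (intro eq_matI) (auto simp: perturbed_def)

section \<open>The normalized Laplacian after deleting an edge\<close>

definition inv_sqrt_degree :: "'a \<Rightarrow> real" where
  "inv_sqrt_degree x = 1 / sqrt (if x \<in> e then real k - 1 else k)"

lemma degree_matrix_inv_sqrt_delete_edge:
  "degree_matrix_inv_sqrt (delete_edge X e) vs
    = list_mat vs vs (\<lambda>x y. if x = y then inv_sqrt_degree y else 0)"
proof -
  have "distinct vs" "set vs = pverts X"
    using vs by (auto simp: vertex_ordering_def)
  then show ?thesis
    unfolding degree_matrix_inv_sqrt_def
    by (subst mat_diag_eq_list_mat[where g = "\<lambda>x. 1 / sqrt (real (out_degree (with_proj (delete_edge X e)) x))"])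
      (auto intro!: list_mat_cong simp: inv_sqrt_degree_def degree_delete_edge[OF e])
qed

text \<open>The diagonal scaling is itself of the form \<open>perturbed\<close>, with \<beta> = 0,
  so \<open>det_perturbed_eq\<close> also shows that its determinant is independent of the
  edge.\<close>

lemma det_degree_matrix_inv_sqrt_delete_edge:
  "det (degree_matrix_inv_sqrt (delete_edge X e) vs)
    = det (list_mat vs vs (perturbed (1 / sqrt k) 0 e (1 / sqrt (real k - 1) - 1 / sqrt k) 0))"
  unfolding degree_matrix_inv_sqrt_delete_edge
  by (intro arg_cong[of _ _ det] list_mat_cong) (auto simp: inv_sqrt_degree_def perturbed_def)

lemma normalized_laplacian_delete_edge:
  "normalized_laplacian (delete_edge X e) vs
    = list_mat vs vs (\<lambda>x y. inv_sqrt_degree x * perturbed k (- 1) e (- 1) 1 x y * inv_sqrt_degree y)"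
  unfolding normalized_laplacian_def degree_matrix_inv_sqrt_delete_edge laplacian_delete_edge
  using vs by (intro list_mat_diag_congruence) (simp add: vertex_ordering_def)

text \<open>
  If \<open>k = 1\<close>, the ends of \<open>e\<close> become isolated and \<open>1 / sqrt 0 = 0\<close> makes \<open>D\<^sup>-\<^sup>1\<^sup>/\<^sup>2\<close> singular, so the
  factorisation of \<open>t I - N\<close> used for \<open>k > 1\<close> is not available.
\<close>

lemma normalized_laplacian_delete_edge_degree_1:
  assumes "k = 1"
  shows "normalized_laplacian (delete_edge X e) vs = laplacian (delete_edge X e) vs"
proof -
  \<comment> \<open>For k = 1 the edges of X form a perfect matching, so no arc leaves
    \<open>e\<close>.\<close>
  have matching: "y \<in> e" if xe: "x \<in> e" and xy: "(x, y) \<in> parcs X" for x y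
  proof -
    obtain u where u: "u \<in> e" "(x, u) \<in> parcs X"
      using e xe arc_sym by (auto simp: edges_def)
    have "card (neighbours X x) = 1"
      using card_neighbours assms arc_in_pverts xy by blast
    then obtain z where "neighbours X x = {z}"
      by (auto simp: card_1_singleton_iff)
    moreover have "u \<in> neighbours X x" "y \<in> neighbours X x"
      using u xy by (auto simp: neighbours_def)
    ultimately have "u = y"
      by simp
    then show ?thesis using u by simp
  qed
  have adjacent: "(x, y) \<in> parcs X" if "x \<in> e" "y \<in> e" "x \<noteq> y" for x y
    using that e arc_sym by (auto simp: edges_def)
  have indicator: "inv_sqrt_degree z = (if z \<in> e then 0 else 1)" for z
    unfolding inv_sqrt_degree_def using assms by simp
  \<comment> \<open>The Laplacian already vanishes in the rows and columns of the ends of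
    \<open>e\<close>, exactly those that the 0-1 scaling annihilates.\<close>
  have zero: "perturbed k (- 1) e (- 1) 1 x y = 0" if "x \<in> e \<or> y \<in> e" for x y
    using that matching[of x y] matching[of y x] adjacent[of x y] arc_sym[of x y] arc_irrefl[of x]
    by (auto simp: perturbed_def assms)
  show ?thesis
    unfolding normalized_laplacian_delete_edge laplacian_delete_edge
  proof (rule list_mat_cong)
    fix x y
    show "inv_sqrt_degree x * perturbed k (- 1) e (- 1) 1 x y * inv_sqrt_degree y
        = perturbed k (- 1) e (- 1) 1 x y"
      using zero[of x y] indicator[of x] indicator[of y] by auto
  qed
qed

text \<open>With D and L taken after the deletion, t I - N = D^{-1/2} (t D - L) D^{-1/2}. Here t D -
  L = (t - 1) D + A', where A' is the new adjacency matrix; at the ends of \<open>e\<close> the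
  diagonal entry (t - 1)(k - 1) exceeds t k - k by 1 - t.\<close>

lemma poly_char_poly_normalized_laplacian_delete_edge:
  assumes "k > 1"
  shows "poly (char_poly (normalized_laplacian (delete_edge X e) vs)) t
    = det (degree_matrix_inv_sqrt (delete_edge X e) vs)
      * det (list_mat vs vs (perturbed (t * k - k) 1 e (1 - t) (- 1)))
      * det (degree_matrix_inv_sqrt (delete_edge X e) vs)"
proof -
  have d: "distinct vs"
    using vs by (simp add: vertex_ordering_def)
  let ?S = "list_mat vs vs (\<lambda>x y. if x = y then inv_sqrt_degree y else 0)"
  let ?T = "list_mat vs vs (perturbed (t * k - k) 1 e (1 - t) (- 1))"
  \<comment> \<open>This is D^{-1/2} D D^{-1/2} = I; k > 1 keeps the degree k - 1 at the ends of
    \<open>e\<close> positive.\<close>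
  have *: "inv_sqrt_degree x * inv_sqrt_degree x * (if x \<in> e then real k - 1 else k) = 1" for x
    using assms by (auto simp: inv_sqrt_degree_def)
  have entry: "(if x = y then t else 0) - inv_sqrt_degree x * perturbed k (- 1) e (- 1) 1 x y * inv_sqrt_degree y
      = inv_sqrt_degree x * perturbed (t * k - k) 1 e (1 - t) (- 1) x y * inv_sqrt_degree y" for x y
  proof -
    let ?d = "if x \<in> e then real k - 1 else k"
    have "perturbed (t * k - k) 1 e (1 - t) (- 1) x y
        = (if x = y then t * ?d else 0) - perturbed k (- 1) e (- 1) 1 x y"
      by (auto simp: perturbed_def algebra_simps)
    moreover have "inv_sqrt_degree x * (if x = y then t * ?d else 0) * inv_sqrt_degree y = (if x = y then t else 0)"
      using arg_cong[OF *[of x], of "\<lambda>z. t * z"]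
      by (auto simp only: mult_ac mult_1_right mult_zero_right if_True if_False split: if_split)
    ultimately show ?thesis
      by (simp only: right_diff_distrib left_diff_distrib)
  qed
  have "poly (char_poly (normalized_laplacian (delete_edge X e) vs)) t = det (?S * ?T * ?S)"
    unfolding normalized_laplacian_delete_edge poly_char_poly_list_mat[OF d]
      list_mat_diag_congruence[OF d] entry ..
  also have "\<dots> = det ?S * det ?T * det ?S"
    by (simp add: det_mult[of _ "length vs"] mult_carrier_mat[of _ "length vs" "length vs"])
  finally show ?thesis
    unfolding degree_matrix_inv_sqrt_delete_edge .
qed

end

lemma char_poly_normalized_laplacian_delete_edge_eq:
  assumes vs: "vertex_ordering X vs" and ws: "vertex_ordering X ws"
    and e: "e \<in> edges X" and f: "f \<in> edges X"
  shows "char_poly (normalized_laplacian (delete_edge X e) vs)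
       = char_poly (normalized_laplacian (delete_edge X f) ws)"
proof -
  \<comment> \<open>The existence of an edge excludes k = 0.\<close>
  obtain u v where "(u, v) \<in> parcs X"
    using e by (auto simp: edges_def)
  then have "u \<in> pverts X" "v \<in> neighbours X u"
    using arc_in_pverts by (auto simp: neighbours_def)
  moreover have "finite (neighbours X u)"
    using neighbours_subset pair_finite_verts finite_subset by blast
  ultimately have "k > 0"
    using card_neighbours[of u] by (auto simp: card_gt_0_iff)
  then consider "k = 1" | "k > 1" by linarith
  then show ?thesis
  proof cases
    case 1
    then show ?thesis
      using char_poly_perturbed_eq[OF assms] vs ws e f
      by (simp add: normalized_laplacian_delete_edge_degree_1 laplacian_delete_edge)
  next
    case 2
    show ?thesis
    proof (rule iffD1[OF poly_eq_poly_eq_iff], rule ext)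
      fix t
      show "poly (char_poly (normalized_laplacian (delete_edge X e) vs)) t
          = poly (char_poly (normalized_laplacian (delete_edge X f) ws)) t"
        \<comment> \<open>Each of the three determinant factors is independent of the edge: \<beta>
          = 0 for the outer two and \<beta> = 1 for the middle one.\<close>
        using det_perturbed_eq[OF assms]
        by (simp only: poly_char_poly_normalized_laplacian_delete_edge[OF vs e 2]
            poly_char_poly_normalized_laplacian_delete_edge[OF ws f 2]
            det_degree_matrix_inv_sqrt_delete_edge[OF vs e]
            det_degree_matrix_inv_sqrt_delete_edge[OF ws f])
    qed
  qed
qed

end

section \<open>From the definition to the locale, and the conclusion\<close>

lemma strongly_regularE:
  assumes "strongly_regular X"
  obtains k a c where "strongly_regular_graph X k a c"
proof -
  interpret pair_graph X
    using assms by (simp add: strongly_regular_def)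
  obtain k a c where
    "\<forall>v \<in> pverts X. out_degree (with_proj X) v = k"
    "\<forall>u \<in> pverts X. \<forall>v \<in> pverts X. (u, v) \<in> parcs X \<longrightarrow> card (neighbours X u \<inter> neighbours X v) = a"
    "\<forall>u \<in> pverts X. \<forall>v \<in> pverts X. u \<noteq> v \<and> (u, v) \<notin> parcs X \<longrightarrow>
       card (neighbours X u \<inter> neighbours X v) = c"
    using assms by (auto simp: strongly_regular_def)
  moreover have "u \<in> pverts X" "v \<in> pverts X" if "(u, v) \<in> parcs X" for u v
    using that arc_fst_in_verts arc_snd_in_verts by fastforce+
  ultimately have "strongly_regular_graph X k a c"
    by unfold_locales (simp_all add: out_degree_eq_card_neighbours)
  then show thesis by (rule that)
qed

theorem theorem1p1:
  fixes X :: "'a pair_pre_digraph" and e f :: "'a set"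
  assumes "strongly_regular X"
    and "e \<in> edges X" and "f \<in> edges X"
  shows "cospectral adjacency_matrix (delete_edge X e) (delete_edge X f)
       \<and> cospectral laplacian (delete_edge X e) (delete_edge X f)
       \<and> cospectral unsigned_laplacian (delete_edge X e) (delete_edge X f)
       \<and> cospectral normalized_laplacian (delete_edge X e) (delete_edge X f)"
proof -
  obtain k a c where "strongly_regular_graph X k a c"
    using assms(1) by (rule strongly_regularE)
  then interpret strongly_regular_graph X k a c .
  note e = assms(2) and f = assms(3)
  show ?thesis
    unfolding cospectral_def vertex_ordering_delete_edge
  proof (intro conjI allI impI)
    fix vs ws assume vs: "vertex_ordering X vs" and ws: "vertex_ordering X ws"
    note [simp] = adjacency_matrix_delete_edge laplacian_delete_edge unsigned_laplacian_delete_edge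
    show "char_poly (adjacency_matrix (delete_edge X e) vs)
        = char_poly (adjacency_matrix (delete_edge X f) ws)"
      and "char_poly (laplacian (delete_edge X e) vs) = char_poly (laplacian (delete_edge X f) ws)"
      and "char_poly (unsigned_laplacian (delete_edge X e) vs)
        = char_poly (unsigned_laplacian (delete_edge X f) ws)"
      using vs ws e f by (simp_all add: char_poly_perturbed_eq[OF vs ws e f])
    show "char_poly (normalized_laplacian (delete_edge X e) vs)
        = char_poly (normalized_laplacian (delete_edge X f) ws)"
      by (rule char_poly_normalized_laplacian_delete_edge_eq[OF vs ws e f])
  qed
qed

end
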